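(* Every rayless graph $G$ (i.e. every graph, of arbitrary cardinality, containing no ray) has an unfriendly partition.
   Context: A ray is a one-way infinite path. A partition of a graph $G=(V,E)$ is a function $\pi: V\to\{0,1\}$. For a vertex $x$, a neighbour $y$ of $x$ is an opponent of $x$ if $\pi(y)\neq\pi(x)$ and a friend if $\pi(y)=\pi(x)$. A vertex is happy in $\pi$ if the (cardinal) number of its opponents is at least the number of its friends. A partition is unfriendly if every vertex is happy in it. *)

theory Defs
  imports "Graph_Theory.Pair_Digraph" "HOL-Library.FuncSet"
begin

unbundle cardinal_syntax

text \<open>A simple undirected graph of arbitrary cardinality is a \<^locale>\<open>pair_bidirected_digraph\<close>:
  a symmetric loop-free arc relation on a vertex set, with no finiteness assumption.
  The edge $xy$ is represented by the two arcs $(x,y)$ and $(y,x)$.\<close>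

definition neighbours :: "'a pair_pre_digraph \<Rightarrow> 'a \<Rightarrow> 'a set" where
  "neighbours G x = {y. (x, y) \<in> parcs G}"

definition is_ray :: "'a pair_pre_digraph \<Rightarrow> (nat \<Rightarrow> 'a) \<Rightarrow> bool" where
  "is_ray G r \<longleftrightarrow> inj r \<and> range r \<subseteq> pverts G \<and> (\<forall>n. (r n, r (Suc n)) \<in> parcs G)"

definition rayless :: "'a pair_pre_digraph \<Rightarrow> bool" where
  "rayless G \<longleftrightarrow> \<not> (\<exists>r. is_ray G r)"

definition graph_partition :: "'a pair_pre_digraph \<Rightarrow> ('a \<Rightarrow> nat) \<Rightarrow> bool" where
  "graph_partition G \<pi> \<longleftrightarrow> \<pi> \<in> pverts G \<rightarrow> {0, 1}"

definition opponents :: "'a pair_pre_digraph \<Rightarrow> ('a \<Rightarrow> nat) \<Rightarrow> 'a \<Rightarrow> 'a set" where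
  "opponents G \<pi> x = {y \<in> neighbours G x. \<pi> y \<noteq> \<pi> x}"

definition friends :: "'a pair_pre_digraph \<Rightarrow> ('a \<Rightarrow> nat) \<Rightarrow> 'a \<Rightarrow> 'a set" where
  "friends G \<pi> x = {y \<in> neighbours G x. \<pi> y = \<pi> x}"

definition happy :: "'a pair_pre_digraph \<Rightarrow> ('a \<Rightarrow> nat) \<Rightarrow> 'a \<Rightarrow> bool" where
  "happy G \<pi> x \<longleftrightarrow> |friends G \<pi> x| \<le>o |opponents G \<pi> x|"

definition unfriendly_partition :: "'a pair_pre_digraph \<Rightarrow> ('a \<Rightarrow> nat) \<Rightarrow> bool" where
  "unfriendly_partition G \<pi> \<longleftrightarrow> graph_partition G \<pi> \<and> (\<forall>x \<in> pverts G. happy G \<pi> x)"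

end

theory Submission
  imports Defs "HOL-Library.Countable_Set_Type"
begin

text \<open>By induction on Schmidt's rank of \<open>A\<close> we show, for every set \<open>A\<close> of vertices containing no ray,
  that any colouring can be changed on \<open>A\<close> alone so as to make all of \<open>A\<close> happy.
  If \<open>A\<close> is infinite, choose a smallest finite \<open>T \<subseteq> A\<close> such that all components of \<open>A - T\<close> have
  smaller rank. By minimality every \<open>v \<in> T\<close> has neighbours in infinitely many components of
  \<open>A - T\<close>; otherwise \<open>v\<close> and these components could be merged without increasing the rank.
  Start with a colouring that makes \<open>A - T\<close> happy and treat the vertices of \<open>T\<close> in order of
  decreasing degree. If \<open>v \<in> T\<close> is unhappy, it has fewer than \<open>deg v\<close> opponents. Flip \<open>v\<close>; the
  damage in \<open>A - T\<close> can be repaired by the induction hypothesis inside a set \<open>Y\<close> that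
  has at most \<open>max(\<aleph>\<^sub>0, #opponents)\<close> elements and meets only components containing former
  opponents of \<open>v\<close>. If \<open>deg v\<close> is uncountable, the size of \<open>Y\<close> is too small to harm \<open>v\<close> or a
  vertex of larger degree. If \<open>deg v\<close> is countable, \<open>Y\<close> lies in finitely many components, which
  does not matter to a vertex with opponents in infinitely many components.\<close>

section \<open>Comparison of cardinals\<close>

lemma not_card_of_ordLeq_iff: "\<not> |A| \<le>o |B| \<longleftrightarrow> |B| <o |A|"
  by (rule not_ordLeq_iff_ordLess) (rule card_of_Well_order)+

lemma finite_ordLess_infinite_set:
  assumes "finite A" "infinite B" shows "|A| <o |B|"
  using assms card_of_ordLeq_finite not_card_of_ordLeq_iff by blast

lemma countable_ordLeq_infinite:
  assumes "countable A" "infinite B" shows "|A| \<le>o |B|"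
  using assms(1)[unfolded countable_card_of_nat] assms(2)[unfolded infinite_iff_card_of_nat]
  by (rule ordLeq_transitive)

lemma countable_ordLess_uncountable:
  assumes "countable A" "uncountable B" shows "|A| <o |B|"
  using assms countable_ordLeq[of B A] not_card_of_ordLeq_iff by blast

section \<open>Colourings and happiness\<close>

locale simple_graph =
  fixes E :: "('a \<times> 'a) set"
  assumes adj_sym: "(x, y) \<in> E \<Longrightarrow> (y, x) \<in> E"
    and adj_irrefl: "(x, x) \<notin> E"
begin

definition nbr :: "'a \<Rightarrow> 'a set" where
  "nbr x = {y. (x, y) \<in> E}"

definition opp :: "('a \<Rightarrow> bool) \<Rightarrow> 'a \<Rightarrow> 'a set" where
  "opp \<pi> x = {y \<in> nbr x. \<pi> y \<noteq> \<pi> x}"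

definition fr :: "('a \<Rightarrow> bool) \<Rightarrow> 'a \<Rightarrow> 'a set" where
  "fr \<pi> x = {y \<in> nbr x. \<pi> y = \<pi> x}"

definition content :: "('a \<Rightarrow> bool) \<Rightarrow> 'a \<Rightarrow> bool" where
  "content \<pi> x \<longleftrightarrow> |fr \<pi> x| \<le>o |opp \<pi> x|"

text \<open>A colouring off \<open>A\<close> is a boundary condition; happiness on \<open>A\<close> refers to the whole graph.
  Thus no subgraphs have to be formed in the induction.\<close>

definition extendable :: "'a set \<Rightarrow> bool" where
  "extendable A \<longleftrightarrow>
    (\<forall>\<pi>\<^sub>0. \<exists>\<pi>. (\<forall>x. x \<notin> A \<longrightarrow> \<pi> x = \<pi>\<^sub>0 x) \<and> (\<forall>x\<in>A. content \<pi> x))"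

definition component :: "'a set \<Rightarrow> 'a \<Rightarrow> 'a set" where
  "component A x = {y. (x, y) \<in> (Restr E A)\<^sup>*}"

definition conn :: "'a set \<Rightarrow> bool" where
  "conn C \<longleftrightarrow> C \<noteq> {} \<and> (\<forall>x\<in>C. C \<subseteq> component C x)"

lemma nbr_eq: "nbr x = fr \<pi> x \<union> opp \<pi> x"
  by (auto simp: fr_def opp_def)

text \<open>If \<open>opp\<close> were smaller than an infinite neighbourhood, \<open>fr\<close>
  would be too, and so would their union, which is the whole neighbourhood.\<close>

lemma content_infinite_iff:
  assumes "infinite (nbr x)"
  shows "content \<pi> x \<longleftrightarrow> |nbr x| \<le>o |opp \<pi> x|"
proof
  assume c: "content \<pi> x"
  show "|nbr x| \<le>o |opp \<pi> x|"
  proof (rule ccontr)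
    assume "\<not> |nbr x| \<le>o |opp \<pi> x|"
    then have o: "|opp \<pi> x| <o |nbr x|" by (simp add: not_card_of_ordLeq_iff)
    then have "|fr \<pi> x| <o |nbr x|"
      using c unfolding content_def by (rule ordLeq_ordLess_trans[rotated])
    then have "|fr \<pi> x \<union> opp \<pi> x| <o |nbr x|"
      using o assms by (intro card_of_Un_ordLess_infinite)
    then show False
      unfolding nbr_eq[symmetric] using ordLess_irreflexive by blast
  qed
next
  assume "|nbr x| \<le>o |opp \<pi> x|"
  moreover have "|fr \<pi> x| \<le>o |nbr x|"
    by (rule card_of_mono1) (auto simp: fr_def)
  ultimately show "content \<pi> x"
    unfolding content_def using ordLeq_transitive by blast
qed

text \<open>A happy vertex of infinite degree has as many opponents as neighbours; changing fewer
  colours than that cannot reduce this number.\<close>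

lemma content_robust:
  assumes c: "content \<pi> x" and "infinite Z" and Z: "|Z| <o |nbr x|"
    and Y: "|Y| \<le>o |Z|" and eq: "\<And>y. y \<notin> Y \<Longrightarrow> y \<noteq> v \<Longrightarrow> \<pi>' y = \<pi> y"
    and x: "x \<notin> Y" "x \<noteq> v"
  shows "content \<pi>' x"
proof -
  have inf: "infinite (nbr x)"
    using assms(2) Z card_of_ordLeq_infinite ordLess_imp_ordLeq by blast
  have "|nbr x| \<le>o |opp \<pi>' x|"
  proof (rule ccontr)
    assume "\<not> |nbr x| \<le>o |opp \<pi>' x|"
    then have 1: "|opp \<pi>' x| <o |nbr x|" by (simp add: not_card_of_ordLeq_iff)
    have 2: "|Y| <o |nbr x|" using Y Z ordLeq_ordLess_trans by blast
    have 3: "|{v}| <o |nbr x|" using inf by (simp add: finite_ordLess_infinite_set)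
    have "|opp \<pi>' x \<union> (Y \<union> {v})| <o |nbr x|"
      using inf 1 2 3 by (intro card_of_Un_ordLess_infinite)
    moreover have "opp \<pi> x \<subseteq> opp \<pi>' x \<union> (Y \<union> {v})"
      using eq x by (auto simp: opp_def)
    ultimately have "|opp \<pi> x| <o |nbr x|"
      using card_of_mono1 ordLeq_ordLess_trans by blast
    then show False
      using c content_infinite_iff[OF inf] not_ordLess_ordLeq by blast
  qed
  then show ?thesis using content_infinite_iff[OF inf] by blast
qed


subsection \<open>Components\<close>

lemma mem_component: "x \<in> component A x"
  by (simp add: component_def)

lemma component_subset:
  assumes "x \<in> A" shows "component A x \<subseteq> A"
proof
  fix y assume "y \<in> component A x"
  then have "(x, y) \<in> (Restr E A)\<^sup>*" by (simp add: component_def)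
  then show "y \<in> A" using assms by (induction rule: rtrancl_induct) auto
qed

lemma component_step:
  assumes "y \<in> component A x" "y \<in> A" "z \<in> A" "(y, z) \<in> E"
  shows "z \<in> component A x"
  using assms unfolding component_def by (auto intro: rtrancl_into_rtrancl)

lemma component_closed_subset:
  assumes "x \<in> X" and "\<And>y z. y \<in> X \<Longrightarrow> y \<in> A \<Longrightarrow> z \<in> A \<Longrightarrow> (y, z) \<in> E \<Longrightarrow> z \<in> X"
  shows "component A x \<subseteq> X"
proof
  fix y assume "y \<in> component A x"
  then have "(x, y) \<in> (Restr E A)\<^sup>*" by (simp add: component_def)
  then show "y \<in> X" using assms by (induction rule: rtrancl_induct) auto
qed

lemma component_eq:
  assumes "y \<in> component A x" shows "component A y = component A x"
proof -
  have s: "sym ((Restr E A)\<^sup>*)"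
    by (rule sym_rtrancl) (auto simp: sym_def adj_sym)
  have xy: "(x, y) \<in> (Restr E A)\<^sup>*" using assms by (simp add: component_def)
  then have yx: "(y, x) \<in> (Restr E A)\<^sup>*" using s by (meson symD)
  show ?thesis
    unfolding component_def using xy yx by (auto intro: rtrancl_trans)
qed

lemma component_mono: "A \<subseteq> B \<Longrightarrow> component A x \<subseteq> component B x"
  unfolding component_def using rtrancl_mono[of "Restr E A" "Restr E B"] by blast

text \<open>Paths in \<open>A\<close> that start in a component never leave it, so they connect its
  vertices inside the component itself.\<close>

lemma conn_component:
  assumes "x \<in> A" shows "conn (component A x)"
proof -
  have "component A x \<subseteq> component (component A x) y" if y: "y \<in> component A x" for y
  proof -
    have "component A y \<subseteq> component (component A x) y \<inter> component A x"
    proof (rule component_closed_subset)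
      show "y \<in> component (component A x) y \<inter> component A x" using y mem_component by blast
    next
      fix u w assume "u \<in> component (component A x) y \<inter> component A x" "u \<in> A" "w \<in> A" "(u, w) \<in> E"
      then show "w \<in> component (component A x) y \<inter> component A x"
        using component_step[of u A x w] component_step[of u "component A x" y w] by blast
    qed
    then show ?thesis using component_eq[OF y] by blast
  qed
  then show ?thesis unfolding conn_def using mem_component by blast
qed

lemma conn_subset_closed:
  assumes "conn C" "x \<in> C" "x \<in> X"
    and "\<And>y z. y \<in> X \<Longrightarrow> y \<in> C \<Longrightarrow> z \<in> C \<Longrightarrow> (y, z) \<in> E \<Longrightarrow> z \<in> X"
  shows "C \<subseteq> X"
  using assms component_closed_subset[of x X C] unfolding conn_def by blast

lemma conn_subset_component:
  assumes "conn C" "x \<in> C" "C \<subseteq> A" shows "C \<subseteq> component A x"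
  using assms component_mono unfolding conn_def by blast

text \<open>Neighbours in \<open>A\<close> of a vertex of \<open>A\<close> lie in its own component,
  and vertices outside \<open>A\<close> keep the colour \<open>\<pi>\<^sub>0\<close>; so colourings
  found separately for the components can be glued.\<close>

lemma extendable_components:
  assumes "\<And>x. x \<in> A \<Longrightarrow> extendable (component A x)"
  shows "extendable A"
  unfolding extendable_def
proof
  fix \<pi>\<^sub>0
  have "\<exists>\<pi>. (\<forall>x. x \<notin> D \<longrightarrow> \<pi> x = \<pi>\<^sub>0 x) \<and> (\<forall>x\<in>D. content \<pi> x)" if "D \<in> component A ` A" for D
    using assms that unfolding extendable_def by blast
  then obtain q where q: "\<And>D x. D \<in> component A ` A \<Longrightarrow> x \<notin> D \<Longrightarrow> q D x = \<pi>\<^sub>0 x"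
    "\<And>D x. D \<in> component A ` A \<Longrightarrow> x \<in> D \<Longrightarrow> content (q D) x"
    by metis
  define \<pi> where "\<pi> x = (if x \<in> A then q (component A x) x else \<pi>\<^sub>0 x)" for x
  have "content \<pi> x" if x: "x \<in> A" for x
  proof -
    have xx: "component A x \<in> component A ` A" using x by blast
    have "\<pi> y = q (component A x) y" if "y = x \<or> y \<in> nbr x" for y
    proof (cases "y \<in> A")
      case True
      then have "y \<in> component A x"
        using that x component_step[OF mem_component x, of y] mem_component by (auto simp: nbr_def)
      then show ?thesis using True component_eq by (simp add: \<pi>_def)
    next
      case False
      then have "y \<notin> component A x" using component_subset[OF x] by blast
      then show ?thesis using False q(1)[OF xx] by (simp add: \<pi>_def)
    qed
    then have "fr \<pi> x = fr (q (component A x)) x" "opp \<pi> x = opp (q (component A x)) x"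
      by (auto simp: fr_def opp_def)
    then show ?thesis using q(2)[OF xx mem_component] by (simp add: content_def)
  qed
  then show "\<exists>\<pi>. (\<forall>x. x \<notin> A \<longrightarrow> \<pi> x = \<pi>\<^sub>0 x) \<and> (\<forall>x\<in>A. content \<pi> x)"
    by (intro exI[of _ \<pi>]) (auto simp: \<pi>_def)
qed


subsection \<open>Finite sets\<close>

text \<open>Minimise the number of monochromatic edges meeting \<open>B\<close>: flipping an unhappy
  vertex would lower it.\<close>

lemma extendable_locally_finite:
  assumes "finite B" and fin: "\<And>x. x \<in> B \<Longrightarrow> finite (nbr x)"
  shows "extendable B"
  unfolding extendable_def
proof
  fix \<pi>\<^sub>0
  \<comment> \<open>\<open>M\<close> holds both arcs of each such edge; restricting to edges that
    meet \<open>B\<close> keeps it finite.\<close>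
  define M where "M \<pi> = {p \<in> E. (fst p \<in> B \<or> snd p \<in> B) \<and> \<pi> (fst p) = \<pi> (snd p)}"
    for \<pi> :: "'a \<Rightarrow> bool"
  have finM: "finite (M \<pi>)" for \<pi>
  proof -
    have "M \<pi> \<subseteq> (SIGMA x:B. nbr x) \<union> prod.swap ` (SIGMA x:B. nbr x)"
      using adj_sym by (fastforce simp: M_def nbr_def)
    moreover have "finite ((SIGMA x:B. nbr x) \<union> prod.swap ` (SIGMA x:B. nbr x))"
      using assms by auto
    ultimately show ?thesis by (rule finite_subset)
  qed
  obtain \<pi> where \<pi>: "\<forall>x. x \<notin> B \<longrightarrow> \<pi> x = \<pi>\<^sub>0 x"
    and min: "\<And>\<pi>'. \<forall>x. x \<notin> B \<longrightarrow> \<pi>' x = \<pi>\<^sub>0 x \<Longrightarrow> card (M \<pi>) \<le> card (M \<pi>')"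
    using ex_has_least_nat[of "\<lambda>\<pi>. \<forall>x. x \<notin> B \<longrightarrow> \<pi> x = \<pi>\<^sub>0 x" \<pi>\<^sub>0 "\<lambda>\<pi>. card (M \<pi>)"]
    by blast
  have "content \<pi> x" if x: "x \<in> B" for x
  proof (rule ccontr)
    assume "\<not> content \<pi> x"
    moreover have f: "finite (fr \<pi> x)" "finite (opp \<pi> x)"
      using fin[OF x] by (auto simp: fr_def opp_def)
    ultimately have lt: "card (opp \<pi> x) < card (fr \<pi> x)"
      unfolding content_def card_of_ordLeq[symmetric] by (metis inj_on_iff_card_le not_le)
    define \<pi>' where "\<pi>' = \<pi>(x := \<not> \<pi> x)"
    define P where "P S = {x} \<times> S \<union> S \<times> {x}" for S
    have cardP: "card (P S) = 2 * card S" if "finite S" "x \<notin> S" for S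
      unfolding P_def using that by (subst card_Un_disjoint) auto
    have nx: "x \<notin> fr \<pi> x" "x \<notin> opp \<pi> x" using adj_irrefl by (auto simp: fr_def nbr_def opp_def)
    have sub: "P (fr \<pi> x) \<subseteq> M \<pi>"
      using x adj_sym by (auto simp: P_def M_def fr_def nbr_def)
    have "M \<pi>' \<subseteq> (M \<pi> - P (fr \<pi> x)) \<union> P (opp \<pi> x)"
    proof
      fix p assume p: "p \<in> M \<pi>'"
      obtain a b where ab: "p = (a, b)" by (cases p)
      have "a \<noteq> b" using p ab adj_irrefl by (auto simp: M_def)
      consider "a = x" | "b = x" | "a \<noteq> x" "b \<noteq> x" by blast
      then show "p \<in> (M \<pi> - P (fr \<pi> x)) \<union> P (opp \<pi> x)"
      proof cases
        case 1
        then have "b \<in> opp \<pi> x"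
          using p ab \<open>a \<noteq> b\<close> by (auto simp: M_def opp_def nbr_def \<pi>'_def)
        then show ?thesis using 1 ab by (simp add: P_def)
      next
        case 2
        then have "a \<in> opp \<pi> x"
          using p ab \<open>a \<noteq> b\<close> adj_sym[of a x] by (auto simp: M_def opp_def nbr_def \<pi>'_def)
        then show ?thesis using 2 ab by (simp add: P_def)
      next
        case 3
        then show ?thesis using p ab by (simp add: M_def P_def \<pi>'_def)
      qed
    qed
    then have "card (M \<pi>') \<le> card ((M \<pi> - P (fr \<pi> x)) \<union> P (opp \<pi> x))"
      using finM f by (intro card_mono) (auto simp: P_def)
    also have "\<dots> \<le> card (M \<pi> - P (fr \<pi> x)) + card (P (opp \<pi> x))"
      by (rule card_Un_le)
    also have "\<dots> = card (M \<pi>) - 2 * card (fr \<pi> x) + 2 * card (opp \<pi> x)"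
      using sub finM f nx cardP by (subst card_Diff_subset) (auto intro: finite_subset)
    also have "\<dots> < card (M \<pi>)"
      using lt card_mono[OF finM sub] cardP[OF f(1) nx(1)] by linarith
    finally have "card (M \<pi>') < card (M \<pi>)" .
    moreover have "\<forall>y. y \<notin> B \<longrightarrow> \<pi>' y = \<pi>\<^sub>0 y" using \<pi> x by (auto simp: \<pi>'_def)
    ultimately show False using min by (meson not_le)
  qed
  then show "\<exists>\<pi>. (\<forall>x. x \<notin> B \<longrightarrow> \<pi> x = \<pi>\<^sub>0 x) \<and> (\<forall>x\<in>B. content \<pi> x)"
    using \<pi> by blast
qed

text \<open>Vertices of infinite degree have all but finitely many neighbours outside
  \<open>A\<close>, where colours are fixed; coloured against a majority there, they stay happy
  whatever \<open>B\<close> receives. The preceding lemma then colours the vertices of finite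
  degree.\<close>

lemma extendable_finite:
  assumes "finite A" shows "extendable A"
  unfolding extendable_def
proof
  fix \<pi>\<^sub>0
  define B where "B = {x \<in> A. finite (nbr x)}"
  define maj where "maj x \<longleftrightarrow> |nbr x| \<le>o |{y \<in> nbr x - A. \<not> \<pi>\<^sub>0 y}|" for x
  have maj': "|nbr x| \<le>o |{y \<in> nbr x - A. \<pi>\<^sub>0 y \<noteq> maj x}|" if inf: "infinite (nbr x)" for x
  \<comment> \<open>If neither colour accounted for the full degree, the neighbourhood would be a
    union of three smaller sets.\<close>
  proof (rule ccontr)
    assume no: "\<not> ?thesis"
    have "\<not> maj x" using no by (cases "maj x") (auto simp: maj_def)
    then have 1: "|{y \<in> nbr x - A. \<not> \<pi>\<^sub>0 y}| <o |nbr x|"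
      by (simp add: maj_def not_card_of_ordLeq_iff)
    have 2: "|{y \<in> nbr x - A. \<pi>\<^sub>0 y}| <o |nbr x|"
      using no \<open>\<not> maj x\<close> by (simp add: not_card_of_ordLeq_iff)
    have 3: "|nbr x \<inter> A| <o |nbr x|"
      using assms inf by (simp add: finite_ordLess_infinite_set)
    have "|{y \<in> nbr x - A. \<not> \<pi>\<^sub>0 y} \<union> ({y \<in> nbr x - A. \<pi>\<^sub>0 y} \<union> (nbr x \<inter> A))| <o |nbr x|"
      using inf 1 2 3 by (intro card_of_Un_ordLess_infinite)
    moreover have "{y \<in> nbr x - A. \<not> \<pi>\<^sub>0 y} \<union> ({y \<in> nbr x - A. \<pi>\<^sub>0 y} \<union> (nbr x \<inter> A)) = nbr x"
      by blast
    ultimately show False using ordLess_irreflexive by metis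
  qed
  have "extendable B"
    using assms by (intro extendable_locally_finite) (auto simp: B_def)
  from spec[OF this[unfolded extendable_def], of "\<lambda>x. if x \<in> A then maj x else \<pi>\<^sub>0 x"] obtain \<pi> where \<pi>: "\<And>x. x \<notin> B \<Longrightarrow> \<pi> x = (if x \<in> A then maj x else \<pi>\<^sub>0 x)"
    and c: "\<And>x. x \<in> B \<Longrightarrow> content \<pi> x"
    by blast
  have "content \<pi> x" if x: "x \<in> A" for x
  proof (cases "finite (nbr x)")
    case True
    then show ?thesis using c x by (simp add: B_def)
  next
    case False
    then have "\<pi> x = maj x" using x \<pi>[of x] by (auto simp: B_def)
    then have "{y \<in> nbr x - A. \<pi>\<^sub>0 y \<noteq> maj x} \<subseteq> opp \<pi> x"
      using \<pi> by (auto simp: opp_def B_def)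
    then show ?thesis
      using maj'[OF False] card_of_mono1 ordLeq_transitive content_infinite_iff[OF False] by blast
  qed
  moreover have "\<forall>x. x \<notin> A \<longrightarrow> \<pi> x = \<pi>\<^sub>0 x" using \<pi> by (auto simp: B_def)
  ultimately show "\<exists>\<pi>. (\<forall>x. x \<notin> A \<longrightarrow> \<pi> x = \<pi>\<^sub>0 x) \<and> (\<forall>x\<in>A. content \<pi> x)" by blast
qed

subsection \<open>Recolouring a finite set of vertices of infinite degree\<close>

text \<open>Walks of length \<open>n\<close> from \<open>x\<close> inside \<open>L\<close> end in
  \<open>S n\<close>. Each \<open>S n\<close> has at most \<open>|Z|\<close> elements, and countably
  many of them cover the component.\<close>

lemma card_of_component:
  assumes "infinite Z" and x: "x \<in> L" and deg: "\<And>y. y \<in> L \<Longrightarrow> |nbr y| \<le>o |Z|"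
  shows "|component L x| \<le>o |Z|"
proof -
  define S where "S n = ((\<lambda>X. \<Union>y\<in>X. nbr y \<inter> L) ^^ n) {x}" for n
  have S_Suc: "S (Suc n) = (\<Union>y\<in>S n. nbr y \<inter> L)" for n by (simp add: S_def)
  have S: "S n \<subseteq> L \<and> |S n| \<le>o |Z|" for n
  proof (induction n)
    case 0
    have "|{x}| \<le>o |Z|" using assms(1) finite_ordLess_infinite_set ordLess_imp_ordLeq by blast
    then show ?case using x by (simp add: S_def)
  next
    case (Suc n)
    have "|nbr y \<inter> L| \<le>o |Z|" if "y \<in> S n" for y
      using that Suc deg card_of_mono1[of "nbr y \<inter> L" "nbr y"] ordLeq_transitive by blast
    then have "|S (Suc n)| \<le>o |Z|"
      unfolding S_Suc using Suc assms(1) by (intro card_of_UNION_ordLeq_infinite) auto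
    then show ?case by (auto simp: S_Suc)
  qed
  have "component L x \<subseteq> (\<Union>n. S n)"
  proof (rule component_closed_subset)
    show "x \<in> (\<Union>n. S n)" by (auto simp: S_def intro: exI[of _ 0])
  next
    fix y z assume "y \<in> (\<Union>n. S n)" "z \<in> L" "(y, z) \<in> E"
    then obtain n where "z \<in> S (Suc n)" by (auto simp: S_Suc nbr_def)
    then show "z \<in> (\<Union>n. S n)" by blast
  qed
  moreover have "|\<Union>n. S n| \<le>o |Z|"
    using S assms(1) infinite_iff_card_of_nat by (intro card_of_UNION_ordLeq_infinite) auto
  ultimately show ?thesis using card_of_mono1 ordLeq_transitive by blast
qed

text \<open>After flipping \<open>v\<close>, only its former opponents can become unhappy. Vertices with more than
  \<open>|Z|\<close> neighbours do not notice \<open>|Z|\<close> changes, so it suffices to recolour what is reachable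
  from the former opponents through vertices of degree at most \<open>|Z|\<close>.\<close>

lemma flip_and_repair:
  assumes ext: "\<And>B. B \<subseteq> W \<Longrightarrow> extendable B"
    and c: "\<And>x. x \<in> W \<Longrightarrow> content \<pi> x" and v: "v \<notin> W"
    and Z: "infinite Z" "|opp \<pi> v| \<le>o |Z|"
  obtains \<pi>' Y where "\<forall>x\<in>W. content \<pi>' x" "\<pi>' v \<noteq> \<pi> v" "Y \<subseteq> W" "|Y| \<le>o |Z|"
    "\<forall>x. x \<notin> Y \<longrightarrow> x \<noteq> v \<longrightarrow> \<pi>' x = \<pi> x"
    "component W ` Y \<subseteq> component W ` (opp \<pi> v \<inter> W)"
proof -
  define L where "L = {x \<in> W. |nbr x| \<le>o |Z|}"
  define Y where "Y = (\<Union>x\<in>opp \<pi> v \<inter> L. component L x)"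
  have LW: "L \<subseteq> W" by (auto simp: L_def)
  have YL: "Y \<subseteq> L" using component_subset unfolding Y_def by blast
  have "|opp \<pi> v \<inter> L| \<le>o |Z|"
    using Z(2) card_of_mono1[of "opp \<pi> v \<inter> L" "opp \<pi> v"] ordLeq_transitive by blast
  then have cardY: "|Y| \<le>o |Z|"
    unfolding Y_def using Z(1)
    by (intro card_of_UNION_ordLeq_infinite ballI card_of_component) (auto simp: L_def)
  have closed: "z \<in> Y" if "y \<in> Y" "z \<in> L" "(y, z) \<in> E" for y z
    using that YL component_step unfolding Y_def by blast
  have "component W y \<in> component W ` (opp \<pi> v \<inter> W)" if "y \<in> Y" for y
  proof -
    obtain x where x: "x \<in> opp \<pi> v \<inter> L" "y \<in> component L x" using \<open>y \<in> Y\<close> unfolding Y_def by blast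
    then have "component W y = component W x" using component_eq component_mono[OF LW] by blast
    then show ?thesis using x LW by blast
  qed
  then have Ycomp: "component W ` Y \<subseteq> component W ` (opp \<pi> v \<inter> W)" by blast
  have "extendable Y" using ext YL LW by blast
  from spec[OF this[unfolded extendable_def], of "\<pi>(v := \<not> \<pi> v)"] obtain \<pi>' where \<pi>': "\<And>x. x \<notin> Y \<Longrightarrow> \<pi>' x = (\<pi>(v := \<not> \<pi> v)) x"
    and cY: "\<And>x. x \<in> Y \<Longrightarrow> content \<pi>' x"
    by blast
  have vY: "v \<notin> Y" using v YL LW by blast
  have eq: "\<pi>' x = \<pi> x" if "x \<notin> Y" "x \<noteq> v" for x
    using \<pi>' that by simp
  have flip: "\<pi>' v \<noteq> \<pi> v" using \<pi>' vY by simp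
  have "content \<pi>' x" if x: "x \<in> W" for x
  proof (cases "x \<in> Y")
    case True
    then show ?thesis by (rule cY)
  next
    case xY: False
    have xv: "x \<noteq> v" using x v by blast
    show ?thesis
    proof (cases "x \<in> L")
      case True
      \<comment> \<open>A vertex of \<open>L\<close> outside \<open>Y\<close> has no neighbour in
        \<open>Y\<close>, so only the flip of \<open>v\<close> can affect it; not being a former
        opponent of \<open>v\<close>, it can only gain an opponent.\<close>
      have nY: "y \<notin> Y" if "y \<in> nbr x" for y
        using that closed True xY adj_sym by (auto simp: nbr_def)
      have "x \<notin> opp \<pi> v"
        using xY True mem_component by (auto simp: Y_def)
      then have xf: "\<pi> x = \<pi> v" if "v \<in> nbr x"
        using that adj_sym by (auto simp: opp_def nbr_def)
      have "\<pi>' y = \<pi> x \<longrightarrow> \<pi> y = \<pi> x" if "y \<in> nbr x" for y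
        using eq[OF nY[OF that]] xf that flip by (cases "y = v") auto
      then have "fr \<pi>' x \<subseteq> fr \<pi> x" "opp \<pi> x \<subseteq> opp \<pi>' x"
        using eq[OF xY xv] by (auto simp: fr_def opp_def)
      then show ?thesis
        using c[OF x] card_of_mono1 ordLeq_transitive unfolding content_def by meson
    next
      case False
      then have "|Z| <o |nbr x|" using x by (simp add: L_def not_card_of_ordLeq_iff)
      then show ?thesis
        using content_robust[OF c[OF x] Z(1) _ cardY] eq xY xv by blast
    qed
  qed
  then show thesis using flip YL LW cardY eq Ycomp by (intro that[of \<pi>' Y]) auto
qed

text \<open>For vertices of countable degree, having opponents in infinitely many components is what
  survives a recolouring that is confined to finitely many components.\<close>

definition settled :: "'a set \<Rightarrow> ('a \<Rightarrow> bool) \<Rightarrow> 'a \<Rightarrow> bool" where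
  "settled W \<pi> u \<longleftrightarrow>
    content \<pi> u \<and> (countable (nbr u) \<longrightarrow> infinite (component W ` (opp \<pi> u \<inter> W)))"

text \<open>Opponents in infinitely many components are infinitely many, which for a vertex of
  countable degree already implies happiness.\<close>

lemma settled_countable_iff:
  assumes "countable (nbr u)"
  shows "settled W \<pi> u \<longleftrightarrow> infinite (component W ` (opp \<pi> u \<inter> W))"
proof -
  have "content \<pi> u" if "infinite (component W ` (opp \<pi> u \<inter> W))"
  proof -
    have inf: "infinite (opp \<pi> u)" using that by blast
    then have "|nbr u| \<le>o |opp \<pi> u|"
      using assms by (intro countable_ordLeq_infinite)
    moreover have "infinite (nbr u)" using inf nbr_eq[of u \<pi>] by simp
    ultimately show ?thesis using content_infinite_iff by blast
  qed
  then show ?thesis using assms by (auto simp: settled_def)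
qed

lemma ex_min_degree:
  assumes "U \<noteq> {}"
  obtains v where "v \<in> U" "\<And>u. u \<in> U \<Longrightarrow> |nbr v| \<le>o |nbr u|"
proof -
  have "wf (inv_image ordLess (\<lambda>u. |nbr u| ))" by (intro wf_inv_image wf_ordLess)
  then obtain v where "v \<in> U" "\<And>u. |nbr u| <o |nbr v| \<Longrightarrow> u \<notin> U"
    using assms wfE_min'[of _ U] by (metis in_inv_image)
  then show thesis using that not_card_of_ordLeq_iff by blast
qed

text \<open>The induction removes from \<open>U\<close> a vertex \<open>v\<close> of least degree,
  which is therefore treated last, when all vertices to be protected have at least its
  degree.\<close>

lemma ex_settled_colouring:
  assumes ext: "\<And>B. B \<subseteq> W \<Longrightarrow> extendable B"
    and "finite U" "U \<inter> W = {}" "\<And>u. u \<in> U \<Longrightarrow> infinite (component W ` (nbr u \<inter> W))"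
  shows "\<exists>\<pi>. (\<forall>x. x \<notin> W \<union> U \<longrightarrow> \<pi> x = \<pi>\<^sub>0 x) \<and> (\<forall>x\<in>W. content \<pi> x) \<and> (\<forall>u\<in>U. settled W \<pi> u)"
  using assms(2-)
proof (induction U rule: finite_psubset_induct)
  case (psubset U)
  show ?case
  proof (cases "U = {}")
    case True
    then show ?thesis using ext[of W] by (auto simp: extendable_def)
  next
    case False
    then obtain v where v: "v \<in> U" and vmin: "\<And>u. u \<in> U \<Longrightarrow> |nbr v| \<le>o |nbr u|"
      using ex_min_degree by blast
    have vW: "v \<notin> W" using v psubset.prems by blast
    have "U - {v} \<subset> U" using v by blast
    from psubset.IH[OF this] obtain \<pi> where \<pi>: "\<And>x. x \<notin> W \<union> (U - {v}) \<Longrightarrow> \<pi> x = \<pi>\<^sub>0 x"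
      and cW: "\<And>x. x \<in> W \<Longrightarrow> content \<pi> x" and sU: "\<And>u. u \<in> U - {v} \<Longrightarrow> settled W \<pi> u"
      using psubset.prems by (metis Diff_iff Diff_subset Int_mono bot.extremum_uniqueI order_refl)
    have infv: "infinite (component W ` (nbr v \<inter> W))" using psubset.prems(2) v by blast
    then have inf: "infinite (nbr v)" by blast
    show ?thesis
    proof (cases "settled W \<pi> v")
      case True
      have "\<forall>x. x \<notin> W \<union> U \<longrightarrow> \<pi> x = \<pi>\<^sub>0 x" "\<forall>x\<in>W. content \<pi> x" "\<forall>u\<in>U. settled W \<pi> u"
        using True \<pi> cW sU by auto
      then show ?thesis by blast
    next
      case unsettled: False
      \<comment> \<open>\<open>Z\<close> bounds the repair. For uncountable degree a countably
        infinite set is added to the opponents, giving an infinite set still smaller than the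
        degree.\<close>
      have "\<exists>Z :: 'a set. infinite Z \<and> |opp \<pi> v| \<le>o |Z| \<and>
          (countable (nbr v) \<longrightarrow> countable Z) \<and> (uncountable (nbr v) \<longrightarrow> |Z| <o |nbr v| )"
      proof (cases "countable (nbr v)")
        case True
        have "|opp \<pi> v| \<le>o |nbr v|" by (rule card_of_mono1) (auto simp: opp_def)
        then show ?thesis using True inf by (intro exI[of _ "nbr v"]) simp
      next
        case False
        then have "|opp \<pi> v| <o |nbr v|"
          using unsettled content_infinite_iff[OF inf] not_card_of_ordLeq_iff
          by (auto simp: settled_def)
        moreover obtain Q where Q: "Q \<subseteq> nbr v" "countable Q" "infinite Q"
          using inf infinite_countable_subset' by blast
        moreover have "|Q| <o |nbr v|"
          using False Q(2) by (intro countable_ordLess_uncountable)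
        ultimately have "|opp \<pi> v \<union> Q| <o |nbr v|"
          using inf by (intro card_of_Un_ordLess_infinite)
        moreover have "|opp \<pi> v| \<le>o |opp \<pi> v \<union> Q|" by (rule card_of_mono1) blast
        ultimately show ?thesis using False Q(3) by (intro exI[of _ "opp \<pi> v \<union> Q"]) auto
      qed
      then obtain Z :: "'a set" where Z: "infinite Z" "|opp \<pi> v| \<le>o |Z|"
        and Zc: "countable (nbr v) \<longrightarrow> countable Z"
        and Zu: "uncountable (nbr v) \<longrightarrow> |Z| <o |nbr v|"
        by blast
      obtain \<pi>' Y where cW': "\<forall>x\<in>W. content \<pi>' x" and flip: "\<pi>' v \<noteq> \<pi> v"
        and YW: "Y \<subseteq> W" and Y: "|Y| \<le>o |Z|"
        and eq': "\<forall>x. x \<notin> Y \<longrightarrow> x \<noteq> v \<longrightarrow> \<pi>' x = \<pi> x"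
        and Yc: "component W ` Y \<subseteq> component W ` (opp \<pi> v \<inter> W)"
        using flip_and_repair[OF ext cW vW Z] by blast
      note eq = eq'[rule_format]
      have few: "finite (component W ` (opp \<pi> v \<inter> W))" if "countable (nbr v)"
        using unsettled settled_countable_iff[OF that] by blast
      have "settled W \<pi>' v"
      proof (cases "countable (nbr v)")
        case True
        \<comment> \<open>Friends of \<open>v\<close> become opponents unless recoloured, and the
          components meeting \<open>Y\<close> are among the finitely many of
          \<open>few\<close>.\<close>
        have "component W ` (nbr v \<inter> W)
          \<subseteq> component W ` (opp \<pi> v \<inter> W) \<union> component W ` (opp \<pi>' v \<inter> W)"
        proof
          fix D assume "D \<in> component W ` (nbr v \<inter> W)"
          then obtain y where y: "y \<in> nbr v" "y \<in> W" "D = component W y" by blast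
          show "D \<in> component W ` (opp \<pi> v \<inter> W) \<union> component W ` (opp \<pi>' v \<inter> W)"
          proof (cases "y \<in> Y \<or> y \<in> opp \<pi> v")
            case True
            then show ?thesis using Yc y by blast
          next
            case False
            moreover have "y \<noteq> v" using y vW by blast
            ultimately have "y \<in> opp \<pi>' v" using eq[of y] y flip by (auto simp: opp_def)
            then show ?thesis using y by blast
          qed
        qed
        then have "infinite (component W ` (opp \<pi>' v \<inter> W))"
          using few[OF True] infv finite_subset by blast
        then show ?thesis using settled_countable_iff[OF True] by blast
      next
        case False
        have "|nbr v| \<le>o |opp \<pi>' v|"
        proof (rule ccontr)
          assume "\<not> ?thesis"
          then have "|opp \<pi>' v| <o |nbr v|" by (simp add: not_card_of_ordLeq_iff)
          moreover have "|opp \<pi> v| <o |nbr v|" "|Y| <o |nbr v|"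
            using mp[OF Zu False] Z(2) Y ordLeq_ordLess_trans by blast+
          ultimately have "|opp \<pi>' v \<union> (opp \<pi> v \<union> Y)| <o |nbr v|"
            using inf by (intro card_of_Un_ordLess_infinite)
          moreover have "nbr v \<subseteq> opp \<pi>' v \<union> (opp \<pi> v \<union> Y)"
          proof
            fix y assume y: "y \<in> nbr v"
            then have "y \<noteq> v" using adj_irrefl by (auto simp: nbr_def)
            then show "y \<in> opp \<pi>' v \<union> (opp \<pi> v \<union> Y)"
              using eq[of y] y flip by (auto simp: opp_def)
          qed
          ultimately show False
            using card_of_mono1 not_ordLess_ordLeq by blast
        qed
        then show ?thesis using False content_infinite_iff[OF inf] by (simp add: settled_def)
      qed
      moreover have "settled W \<pi>' u" if u: "u \<in> U" "u \<noteq> v" for u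
      proof -
        have s: "settled W \<pi> u" using sU u by blast
        have uY: "u \<notin> Y" using u YW psubset.prems(1) by blast
        show ?thesis
        proof (cases "countable (nbr u)")
          case True
          \<comment> \<open>By the minimality of \<open>v\<close>; hence the repair met only
            finitely many components.\<close>
          then have "countable (nbr v)"
            using vmin[OF u(1)] countable_ordLeq by blast
          note few = few[OF this]
          have "component W ` (opp \<pi> u \<inter> W)
            \<subseteq> component W ` (opp \<pi> v \<inter> W) \<union> component W ` (opp \<pi>' u \<inter> W)"
          proof
            fix D assume "D \<in> component W ` (opp \<pi> u \<inter> W)"
            then obtain y where y: "y \<in> opp \<pi> u" "y \<in> W" "D = component W y" by blast
            show "D \<in> component W ` (opp \<pi> v \<inter> W) \<union> component W ` (opp \<pi>' u \<inter> W)"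
            proof (cases "y \<in> Y")
              case True
              then show ?thesis using Yc y by blast
            next
              case False
              moreover have "y \<noteq> v" using y vW by blast
              ultimately have "y \<in> opp \<pi>' u" using eq[of y] eq[OF uY u(2)] y by (auto simp: opp_def)
              then show ?thesis using y by blast
            qed
          qed
          moreover have "infinite (component W ` (opp \<pi> u \<inter> W))"
            using s settled_countable_iff[OF True] by blast
          ultimately have "infinite (component W ` (opp \<pi>' u \<inter> W))"
            using few finite_subset by blast
          then show ?thesis using settled_countable_iff[OF True] by blast
        next
          case False
          \<comment> \<open>If \<open>v\<close> has countable degree then \<open>Z\<close> is
            countable; otherwise \<open>|Z|\<close> lies below the degree of \<open>v\<close>, which
            is at most that of \<open>u\<close>.\<close>
          have "|Z| <o |nbr u|"
          proof (cases "countable (nbr v)")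
            case True
            then show ?thesis
              using Zc False by (intro countable_ordLess_uncountable) blast+
          next
            case False
            then show ?thesis using Zu vmin[OF u(1)] ordLess_ordLeq_trans by blast
          qed
          then have "content \<pi>' u"
            using content_robust[of \<pi> u Z Y v \<pi>'] s Z(1) Y eq uY u(2) by (auto simp: settled_def)
          then show ?thesis using False by (simp add: settled_def)
        qed
      qed
      moreover have "\<pi>' x = \<pi>\<^sub>0 x" if "x \<notin> W \<union> U" for x
      proof -
        have "x \<notin> Y" "x \<noteq> v" using that v YW by auto
        then show ?thesis using eq[of x] \<pi>[of x] that by simp
      qed
      ultimately show ?thesis using cW' by metis
    qed
  qed
qed


subsection \<open>Rank induction\<close>

text \<open>The iterates of \<open>next_rank\<close> are the classes of vertex sets of bounded rank
  in the sense of Schmidt.\<close>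

definition next_rank :: "'a set set \<Rightarrow> 'a set set" where
  "next_rank I = {A. \<exists>T. finite T \<and> (\<forall>C. C \<subseteq> A - T \<longrightarrow> conn C \<longrightarrow> C \<in> I)}"

lemma next_rankE:
  assumes "A \<in> next_rank I"
  obtains T where "finite T" "\<forall>C. C \<subseteq> A - T \<longrightarrow> conn C \<longrightarrow> C \<in> I"
  using assms by (auto simp: next_rank_def)

lemma next_rankI:
  assumes "finite T" "\<And>C. C \<subseteq> A - T \<Longrightarrow> conn C \<Longrightarrow> C \<in> I"
  shows "A \<in> next_rank I"
  using assms by (auto simp: next_rank_def)

text \<open>These closure properties allow \<open>v\<close> to be merged with finitely many
  components. The empty class has them vacuously, so the iteration can start there.\<close>

definition rank_class :: "'a set set \<Rightarrow> bool" where
  "rank_class I \<longleftrightarrow> (\<forall>A\<in>I. \<forall>B\<subseteq>A. B \<in> I) \<and> (\<forall>A\<in>I. \<forall>F. finite F \<longrightarrow> A \<union> F \<in> I) \<and>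
    (\<forall>A\<in>I. \<forall>B\<in>I. A \<inter> B = {} \<longrightarrow> (\<forall>x\<in>A. \<forall>y\<in>B. (x, y) \<notin> E) \<longrightarrow> A \<union> B \<in> I)"

lemma rank_class_subset: "rank_class I \<Longrightarrow> A \<in> I \<Longrightarrow> B \<subseteq> A \<Longrightarrow> B \<in> I"
  by (simp add: rank_class_def)

lemma rank_class_Un_finite: "rank_class I \<Longrightarrow> A \<in> I \<Longrightarrow> finite F \<Longrightarrow> A \<union> F \<in> I"
  by (simp add: rank_class_def)

lemma rank_class_Un:
  assumes "rank_class I" "A \<in> I" "B \<in> I" "A \<inter> B = {}" "\<And>x y. x \<in> A \<Longrightarrow> y \<in> B \<Longrightarrow> (x, y) \<notin> E"
  shows "A \<union> B \<in> I"
  using assms by (simp add: rank_class_def)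

lemma mono_next_rank: "monotone (\<le>) (\<le>) next_rank"
proof (intro monotoneI subsetI)
  fix I J A assume IJ: "I \<subseteq> J" and "A \<in> next_rank I"
  then show "A \<in> next_rank J" by (elim next_rankE) (rule next_rankI, auto)
qed

text \<open>Quantifying over all connected subsets of \<open>A - T\<close>, not only its components,
  gives closure under subsets directly. A connected subset of a union of two non-adjacent sets lies
  in one of them.\<close>

lemma rank_class_next_rank: "rank_class (next_rank I)"
  unfolding rank_class_def
proof (intro conjI ballI allI impI)
  fix A B assume "A \<in> next_rank I" "B \<subseteq> A"
  then show "B \<in> next_rank I" by (elim next_rankE) (rule next_rankI, auto)
next
  fix A F :: "'a set" assume A: "A \<in> next_rank I" and "finite F"
  obtain T where T: "finite T" "\<forall>C. C \<subseteq> A - T \<longrightarrow> conn C \<longrightarrow> C \<in> I"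
    using A by (rule next_rankE) (rule that)
  show "A \<union> F \<in> next_rank I"
  proof (rule next_rankI)
    show "finite (T \<union> F)" using T(1) \<open>finite F\<close> by simp
    show "C \<in> I" if "C \<subseteq> A \<union> F - (T \<union> F)" "conn C" for C
      using that T(2) by blast
  qed
next
  fix A B assume A: "A \<in> next_rank I" and B: "B \<in> next_rank I"
    and AB: "A \<inter> B = {}" "\<forall>x\<in>A. \<forall>y\<in>B. (x, y) \<notin> E"
  obtain T where T: "finite T" "\<forall>C. C \<subseteq> A - T \<longrightarrow> conn C \<longrightarrow> C \<in> I"
    using A by (rule next_rankE) (rule that)
  obtain T' where T': "finite T'" "\<forall>C. C \<subseteq> B - T' \<longrightarrow> conn C \<longrightarrow> C \<in> I"
    using B by (rule next_rankE) (rule that)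
  have "C \<in> I" if C: "C \<subseteq> A \<union> B - (T \<union> T')" "conn C" for C
  proof -
    obtain x where x: "x \<in> C" using C(2) conn_def by blast
    show ?thesis
    proof (cases "x \<in> A")
      case True
      have "C \<subseteq> A"
      proof (rule conn_subset_closed[OF C(2) x True])
        fix y z assume "y \<in> A" "z \<in> C" "(y, z) \<in> E"
        then show "z \<in> A" using AB C(1) by blast
      qed
      then show ?thesis using T C by blast
    next
      case False
      have "C \<subseteq> B"
      proof (rule conn_subset_closed[OF C(2) x])
        show "x \<in> B" using False x C(1) by blast
        fix y z assume "y \<in> B" "z \<in> C" "(y, z) \<in> E"
        then show "z \<in> B" using AB C(1) adj_sym[of y z] by blast
      qed
      then show ?thesis using T' C by blast
    qed
  qed
  then show "A \<union> B \<in> next_rank I"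
    using T(1) T'(1) by (intro next_rankI[of "T \<union> T'"]) auto
qed

text \<open>Distinct components are disjoint and no edge joins them, so they can be added one at a
  time.\<close>

lemma rank_class_Union_components:
  assumes I: "rank_class I" "{} \<in> I" and "finite \<D>"
    and "\<D> \<subseteq> component W ` W" "\<D> \<subseteq> I"
  shows "\<Union>\<D> \<in> I"
  using assms(3-)
proof (induction \<D> rule: finite_induct)
  case empty
  then show ?case using I by simp
next
  case (insert D \<D>)
  obtain d where d: "d \<in> W" "D = component W d" using insert.prems by blast
  have sep: "y \<notin> D \<and> (x, y) \<notin> E" if xy: "x \<in> D" "y \<in> \<Union>\<D>" for x y
  proof -
    obtain w where w: "w \<in> W" "y \<in> component W w" "component W w \<in> \<D>"
      using xy insert.prems by blast
    have "y \<notin> D"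
    proof
      assume "y \<in> D"
      then have "component W w = D" using component_eq w(2) d(2) by metis
      then show False using w insert.hyps by blast
    qed
    moreover have "x \<in> W" "y \<in> W" using xy d w component_subset by blast+
    ultimately show ?thesis using component_step[of x W d y] xy d by blast
  qed
  have "D \<union> \<Union>\<D> \<in> I"
    using insert sep by (intro rank_class_Un[OF I(1)]) auto
  then show ?case by simp
qed

lemma extendable_next_rank:
  assumes I: "rank_class I" "{} \<in> I" and ext: "\<And>A. A \<in> I \<Longrightarrow> extendable A"
    and H: "H \<in> next_rank I"
  shows "extendable H"
proof -
  define sep where "sep T \<longleftrightarrow> finite T \<and> T \<subseteq> H \<and> (\<forall>C. C \<subseteq> H - T \<longrightarrow> conn C \<longrightarrow> C \<in> I)" for T
  obtain T\<^sub>0 where T\<^sub>0: "finite T\<^sub>0" "\<forall>C. C \<subseteq> H - T\<^sub>0 \<longrightarrow> conn C \<longrightarrow> C \<in> I"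
    using H by (rule next_rankE) (rule that)
  have "H - T\<^sub>0 \<inter> H = H - T\<^sub>0" by blast
  then have "sep (T\<^sub>0 \<inter> H)" using T\<^sub>0 by (simp add: sep_def)
  then obtain T where T: "sep T" and min: "\<And>T'. sep T' \<Longrightarrow> card T \<le> card T'"
    using ex_has_least_nat[of sep _ card] by blast
  define W where "W = H - T"
  have finT: "finite T" and TH: "T \<subseteq> H" and TI: "\<And>C. C \<subseteq> W \<Longrightarrow> conn C \<Longrightarrow> C \<in> I"
    using T by (auto simp: sep_def W_def)
  \<comment> \<open>Only connected subsets of \<open>W\<close> are known to lie in \<open>I\<close>,
    hence the passage to components.\<close>
  have extW: "extendable B" if "B \<subseteq> W" for B
  proof (rule extendable_components)
    fix x assume "x \<in> B"
    then show "extendable (component B x)"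
      using that component_subset[of x B] conn_component[of x B] TI ext by blast
  qed
  \<comment> \<open>Otherwise \<open>v\<close> could be removed from the minimal separator \<open>T\<close>.\<close>
  have infT: "infinite (component W ` (nbr v \<inter> W))" if v: "v \<in> T" for v
  proof
    assume fin: "finite (component W ` (nbr v \<inter> W))"
    define U where "U = \<Union>(component W ` (nbr v \<inter> W)) \<union> {v}"
    have "component W ` (nbr v \<inter> W) \<subseteq> I"
      by (auto intro!: TI conn_component dest: subsetD[OF component_subset, rotated])
    then have "\<Union>(component W ` (nbr v \<inter> W)) \<in> I"
      using rank_class_Union_components[OF I fin, of W] by blast
    then have U: "U \<in> I"
      unfolding U_def by (intro rank_class_Un_finite[OF I(1)]) auto
    have "C \<in> I" if C: "C \<subseteq> H - (T - {v})" "conn C" for C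
    proof (cases "v \<in> C")
      case False
      then show ?thesis using TI[OF _ C(2)] C(1) by (auto simp: W_def)
    next
      case True
      \<comment> \<open>From \<open>v\<close>, a path in \<open>C\<close> enters only components of
        \<open>W\<close> that contain a neighbour of \<open>v\<close>, and it can leave such a
        component only through \<open>v\<close>.\<close>
      have "C \<subseteq> U"
      proof (rule conn_subset_closed[OF C(2) True])
        show "v \<in> U" by (simp add: U_def)
      next
        fix y z assume y: "y \<in> U" "y \<in> C" and z: "z \<in> C" and yz: "(y, z) \<in> E"
        show "z \<in> U"
        proof (cases "y = v \<or> z = v")
          case True
          moreover have "z \<in> W" if "z \<noteq> v" using that z C(1) by (auto simp: W_def)
          moreover have "z \<in> nbr v" if "y = v" using that yz by (simp add: nbr_def)
          ultimately show ?thesis using mem_component unfolding U_def by blast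
        next
          case False
          then have "y \<in> W" "z \<in> W" using y z C(1) by (auto simp: W_def)
          moreover obtain u where "u \<in> nbr v \<inter> W" "y \<in> component W u"
            using y False by (auto simp: U_def)
          ultimately show ?thesis using component_step yz unfolding U_def by blast
        qed
      qed
      then show ?thesis using U rank_class_subset[OF I(1)] by blast
    qed
    then have "sep (T - {v})" using finT TH by (auto simp: sep_def)
    then have "card T \<le> card (T - {v})" by (rule min)
    then show False using v finT by (meson card_Diff1_less not_le)
  qed
  have TW: "T \<inter> W = {}" and "W \<union> T = H" using TH by (auto simp: W_def)
  show ?thesis
    unfolding extendable_def
  proof
    fix \<pi>\<^sub>0
    obtain \<pi> where "\<forall>x. x \<notin> W \<union> T \<longrightarrow> \<pi> x = \<pi>\<^sub>0 x" "\<forall>x\<in>W. content \<pi> x" "\<forall>u\<in>T. settled W \<pi> u"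
      using ex_settled_colouring[OF extW finT TW infT] by blast
    then show "\<exists>\<pi>. (\<forall>x. x \<notin> H \<longrightarrow> \<pi> x = \<pi>\<^sub>0 x) \<and> (\<forall>x\<in>H. content \<pi> x)"
      unfolding \<open>W \<union> T = H\<close>[symmetric] settled_def by blast
  qed
qed

section \<open>The least fixed point of \<open>next_rank\<close>\<close>

text \<open>A nonempty \<open>A - T\<close> would contain a connected set, namely one of its
  components; conversely take \<open>T = A\<close>.\<close>

lemma next_rank_empty: "next_rank {} = Collect finite"
proof -
  have "finite A" if "finite T" "\<And>C. C \<subseteq> A - T \<Longrightarrow> \<not> conn C" for A T
  proof -
    have "A - T = {}"
    proof (rule ccontr)
      assume "A - T \<noteq> {}"
      then obtain x where "x \<in> A - T" by blast
      then show False using that(2) component_subset conn_component by metis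
    qed
    then show ?thesis using that(1) finite_subset[of A T] by simp
  qed
  moreover have "\<not> conn C" if "C \<subseteq> A - A" for A C using that by (auto simp: conn_def)
  ultimately show ?thesis by (auto elim!: next_rankE intro: next_rankI)
qed

lemma rank_class_Sup:
  assumes chain: "Complete_Partial_Order.chain (\<le>) M" and M: "\<And>I. I \<in> M \<Longrightarrow> rank_class I"
  shows "rank_class (\<Union>M)"
  unfolding rank_class_def
proof (intro conjI ballI allI impI)
  fix A B assume "A \<in> \<Union>M" "B \<subseteq> A"
  then show "B \<in> \<Union>M" using M rank_class_subset by blast
next
  fix A F :: "'a set" assume "A \<in> \<Union>M" "finite F"
  then show "A \<union> F \<in> \<Union>M" using M rank_class_Un_finite by blast
next
  fix A B assume AB: "A \<in> \<Union>M" "B \<in> \<Union>M" "A \<inter> B = {}" "\<forall>x\<in>A. \<forall>y\<in>B. (x, y) \<notin> E"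
  then obtain I where "I \<in> M" "A \<in> I" "B \<in> I"
    using chain unfolding Complete_Partial_Order.chain_def by blast
  then have "A \<union> B \<in> I" using M AB(3,4) by (intro rank_class_Un) auto
  then show "A \<union> B \<in> \<Union>M" using \<open>I \<in> M\<close> by blast
qed

text \<open>Fixed-point induction replaces transfinite induction on ranks: the fixed point is built
  from the empty class by \<open>next_rank\<close> and unions of chains.\<close>

lemma ranked_extendable:
  "rank_class (ccpo_class.fixp next_rank) \<and> (\<forall>A\<in>ccpo_class.fixp next_rank. extendable A)"
proof (rule fixp_induct[OF _ mono_next_rank])
  show "ccpo.admissible Sup (\<le>) (\<lambda>I. rank_class I \<and> (\<forall>A\<in>I. extendable A))"
    using rank_class_Sup by (intro ccpo.admissibleI) blast
next
  show "rank_class (Sup {}) \<and> (\<forall>A\<in>Sup {}. extendable A)" by (simp add: rank_class_def)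
next
  fix I assume I: "rank_class I \<and> (\<forall>A\<in>I. extendable A)"
  have "extendable A" if A: "A \<in> next_rank I" for A
  proof (cases "I = {}")
    \<comment> \<open>\<open>extendable_next_rank\<close> requires \<open>{} \<in> I\<close>, which
      fails at the first step.\<close>
    case True
    then show ?thesis using A extendable_finite by (simp add: next_rank_empty)
  next
    case False
    then have "{} \<in> I" using I rank_class_subset by blast
    then show ?thesis using extendable_next_rank A I by blast
  qed
  then show "rank_class (next_rank I) \<and> (\<forall>A\<in>next_rank I. extendable A)"
    using rank_class_next_rank by blast
qed

section \<open>Rays in unranked sets\<close>

text \<open>By the fixed-point equation, an unranked set minus a finite set still contains a
  connected unranked set. Iterating this while deleting the current vertex yields a ray.\<close>

lemma ex_ray_if_unranked:
  assumes A: "A \<notin> ccpo_class.fixp next_rank"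
  shows "\<exists>r :: nat \<Rightarrow> 'a. inj r \<and> range r \<subseteq> A \<and> (\<forall>n. (r n, r (Suc n)) \<in> E)"
proof -
  define I where "I = ccpo_class.fixp next_rank"
  have fp: "next_rank I = I"
    unfolding I_def using fixp_unfold[OF mono_next_rank] by simp
  have mono: "B \<in> I" if "C \<in> I" "B \<subseteq> C" for B C
    using ranked_extendable that rank_class_subset unfolding I_def by blast
  have sub: "\<exists>C. C \<subseteq> B - T \<and> conn C \<and> C \<notin> I" if "B \<notin> I" "finite T" for B T
    using that fp next_rankI[of T B I] by blast
  \<comment> \<open>A state is the current end \<open>v\<close> of the path with a connected
    unranked set \<open>C\<close> around it, in which the rest of the ray is sought.\<close>
  define P where "P = (\<lambda>(v, C). v \<in> C \<and> C \<subseteq> A \<and> conn C \<and> C \<notin> I)"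
  define Q where "Q = (\<lambda>(v, C) (v', C'). (v, v') \<in> E \<and> C' \<subseteq> C - {v})"
  have "\<exists>s. \<forall>n. P (s n) \<and> Q (s n) (s (Suc n))"
  proof (rule dependent_nat_choice)
    obtain C where "C \<subseteq> A" "conn C" "C \<notin> I" using sub[of A "{}"] A by (auto simp: I_def)
    then show "\<exists>x. P x" unfolding P_def conn_def by blast
  next
    fix x :: "'a \<times> 'a set" and n :: nat
    assume "P x"
    then obtain v C where x: "x = (v, C)" and C: "v \<in> C" "C \<subseteq> A" "conn C" "C \<notin> I"
      by (auto simp: P_def)
    obtain B where B: "B \<subseteq> C - {v}" "conn B" "B \<notin> I" using sub[OF C(4), of "{v}"] by blast
    then obtain b where b: "b \<in> B" by (auto simp: conn_def)
    \<comment> \<open>\<open>B\<close> need not contain a neighbour of \<open>v\<close>, but its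
      component in \<open>C - {v}\<close> does, since \<open>C\<close> is connected.\<close>
    define D where "D = component (C - {v}) b"
    have bD: "b \<in> D" and DC: "D \<subseteq> C - {v}"
      using B b mem_component component_subset unfolding D_def by blast+
    have "B \<subseteq> D" unfolding D_def using B b by (intro conn_subset_component)
    then have "D \<notin> I" using B mono by blast
    have "\<exists>u\<in>D. (u, v) \<in> E"
    proof (rule ccontr)
      assume no: "\<not> ?thesis"
      have "C \<subseteq> D"
      proof (rule conn_subset_closed[OF C(3) _ bD])
        show "b \<in> C" using b B by blast
      next
        fix y z assume y: "y \<in> D" and z: "z \<in> C" and yz: "(y, z) \<in> E"
        then have "z \<noteq> v" using no by blast
        then show "z \<in> D" using y z yz DC component_step unfolding D_def by blast
      qed
      then show False using C(1) DC by blast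
    qed
    then obtain u where "u \<in> D" "(v, u) \<in> E" using adj_sym by blast
    moreover have "conn D" unfolding D_def using b B by (intro conn_component) blast
    ultimately show "\<exists>y. P y \<and> Q x y"
      using x DC C(2) \<open>D \<notin> I\<close> by (intro exI[of _ "(u, D)"]) (auto simp: P_def Q_def)
  qed
  then obtain s where s: "\<And>n. P (s n)" "\<And>n. Q (s n) (s (Suc n))" by blast
  define r where "r = fst \<circ> s"
  define C where "C = snd \<circ> s"
  have r: "r n \<in> C n" "C n \<subseteq> A" "(r n, r (Suc n)) \<in> E" "C (Suc n) \<subseteq> C n - {r n}" for n
    using s[of n] by (auto simp: r_def C_def P_def Q_def split_beta)
  have "C n \<subseteq> C m" if "m \<le> n" for m n
    using r(4) lift_Suc_antimono_le[of C m n] that by blast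
  \<comment> \<open>\<open>r m\<close> is deleted from \<open>C (Suc m)\<close>, which contains all
    later vertices.\<close>
  then have "r n \<noteq> r m" if "m < n" for m n
    using that r(1)[of n] r(4)[of m] by (metis Diff_iff Suc_leI singletonI subsetD)
  then have "inj r" by (metis injI linorder_neqE_nat)
  then show ?thesis using r by blast
qed

lemma extendable_if_no_ray:
  assumes "\<not> (\<exists>r :: nat \<Rightarrow> 'a. inj r \<and> range r \<subseteq> A \<and> (\<forall>n. (r n, r (Suc n)) \<in> E))"
  shows "extendable A"
  using assms ex_ray_if_unranked ranked_extendable by blast

end

theorem theorem1:
  fixes G :: "'a pair_pre_digraph"
  assumes "pair_bidirected_digraph G"
    and "rayless G"
  shows "\<exists>\<pi>. unfriendly_partition G \<pi>"
proof -
  interpret G: pair_bidirected_digraph G by fact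
  interpret simple_graph "parcs G"
  proof
    show "(y, x) \<in> parcs G" if "(x, y) \<in> parcs G" for x y
      using that G.pair_sym_arcs by (auto simp: symmetric_def sym_def)
    show "(x, x) \<notin> parcs G" for x
      using G.pair_no_loops by fastforce
  qed
  have ext: "extendable (pverts G)"
    using assms(2) by (intro extendable_if_no_ray) (auto simp: rayless_def is_ray_def)
  from spec[OF ext[unfolded extendable_def], of "\<lambda>_. True"]
  obtain \<pi> where \<pi>: "\<forall>x\<in>pverts G. content \<pi> x" by blast
  define \<rho> :: "'a \<Rightarrow> nat" where "\<rho> x = (if \<pi> x then 1 else 0)" for x
  have "friends G \<rho> x = fr \<pi> x" "opponents G \<rho> x = opp \<pi> x" for x
    by (auto simp: friends_def fr_def opponents_def opp_def neighbours_def nbr_def \<rho>_def)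
  then have "unfriendly_partition G \<rho>"
    using \<pi> by (auto simp: unfriendly_partition_def graph_partition_def happy_def content_def \<rho>_def)
  then show ?thesis by blast
qed

end
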